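(* The identity-truthfulness gap is at most $0.81$, even for randomized algorithms. That is, for every (possibly randomized) identity-truthful algorithm $\mathrm{ALG}$, $$\Gamma(\mathrm{ALG})=\inf_{F}\min_{\pi}\frac{\mathbb{E}_{\vec v\sim F}[\mathrm{ALG}(F;\pi,\vec v)]}{\mathbb{E}_{\vec v\sim F}[\mathrm{OPT}(F,\pi;\vec v)]}\le 0.81 ,$$ where the infimum is over all numbers of boxes $n\ge 1$ and all product distributions $F=F_1\times\cdots\times F_n$ of nonnegative rewards (with $0<\mathbb{E}[\max_i v_i]<\infty$), and the minimum is over all arrival orders $\pi$.
   Context: Setting. There are $n$ boxes; box $k$ contains a nonnegative random reward with known distribution $F_k$, independently across boxes; $F=F_1\times\cdots\times F_n$. An arrival order is a permutation $\pi$ of $\{1,\dots,n\}$: the box arriving at step $i$ is box $\pi^{-1}(i)$ (its index is called its identity), and its reward $v_i\sim F_{\pi^{-1}(i)}$ is revealed at step $i$. The decision-maker must immediately and irrevocably decide whether to accept $v_i$ (and stop) or reject it and continue; at most one reward is accepted, and the obtained reward is $0$ if none is accepted. $\mathrm{OPT}(F,\pi;\vec v)$ is the reward obtained by the optimal online (order-aware) algorithm, i.e. the online algorithm maximizing the expected accepted reward among all online algorithms that know $F$ and $\pi$ from the outset (its decision at step $i$ may depend on $F,\pi,v_1,\dots,v_i$). An identity-truthful algorithm knows $F$ from the outset but not $\pi$; its decision at step $i$ may depend only on $F$, on $v_1,\dots,v_i$, and on the identities $\pi^{-1}(1),\dots,\pi^{-1}(i-1)$ of the previously arrived boxes (and not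 on $\pi^{-1}(i)$). It may use internal randomness, in which case expectations are also over this randomness. $\mathrm{ALG}(F;\pi,\vec v)$ denotes its obtained reward. *)

theory Defs
  imports "HOL-Probability.Probability" "HOL-Combinatorics.Permutations"
begin

text \<open>
  An instance is the list of reward distributions, so boxes and steps are indexed from \<open>0\<close>.
  An arrival order \<open>\<pi>\<close> maps a box to the step at which it arrives; the box arriving at step \<open>i\<close>
  is \<open>inv \<pi> i\<close>. Expectations of nonnegative rewards are taken in \<^typ>\<open>ennreal\<close>, where they
  always exist.
\<close>

type_synonym boxes = "real measure list"

definition reward_dist :: "real measure \<Rightarrow> bool" where
  "reward_dist M \<longleftrightarrow> prob_space M \<and> sets M = sets borel \<and> (AE x in M. 0 \<le> x)"

definition expected_max :: "boxes \<Rightarrow> ennreal" where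
  "expected_max F =
     (\<integral>\<^sup>+ v. ennreal (Max (v ` {..<length F})) \<partial>(PiM {..<length F} (\<lambda>k. F ! k)))"

definition admissible :: "boxes \<Rightarrow> bool" where
  "admissible F \<longleftrightarrow> length F \<ge> 1 \<and> (\<forall>M \<in> set F. reward_dist M)
     \<and> 0 < expected_max F \<and> expected_max F < \<infinity>"

definition arrival_orders :: "boxes \<Rightarrow> (nat \<Rightarrow> nat) set" where
  "arrival_orders F = {\<pi>. \<pi> permutes {..<length F}}"

text \<open>The joint law of the revealed rewards, indexed by arrival step.\<close>

definition arrival_dist :: "boxes \<Rightarrow> (nat \<Rightarrow> nat) \<Rightarrow> (nat \<Rightarrow> real) measure" where
  "arrival_dist F \<pi> = PiM {..<length F} (\<lambda>i. F ! (inv \<pi> i))"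

text \<open>
  In the next definition \<open>acc i\<close> is the decision prescribed at step \<open>i\<close> provided that step is
  reached; the first acceptance ends the process.
\<close>

definition obtained_reward :: "nat \<Rightarrow> (nat \<Rightarrow> bool) \<Rightarrow> (nat \<Rightarrow> real) \<Rightarrow> real" where
  "obtained_reward n acc v =
     (if \<exists>i<n. acc i then v (LEAST i. i < n \<and> acc i) else 0)"

text \<open>
  Order-aware algorithms: since \<open>F\<close> and \<open>\<pi>\<close> are known from the outset, such an algorithm is, for
  each \<open>F\<close> and \<open>\<pi>\<close>, an arbitrary measurable rule \<open>d\<close> deciding at step \<open>i\<close> from the list of the
  rewards revealed at steps \<open>0, \<dots>, i\<close>. The expected reward of the optimal one is the supremum.
\<close>

definition online_rule :: "nat \<Rightarrow> (real list \<Rightarrow> bool) \<Rightarrow> bool" where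
  "online_rule n d \<longleftrightarrow>
     (\<forall>i<n. Measurable.pred (PiM {..<n} (\<lambda>_. borel)) (\<lambda>v. d (map v [0..<Suc i])))"

definition expected_online_reward ::
  "boxes \<Rightarrow> (nat \<Rightarrow> nat) \<Rightarrow> (real list \<Rightarrow> bool) \<Rightarrow> ennreal" where
  "expected_online_reward F \<pi> d =
     (\<integral>\<^sup>+ v. ennreal (obtained_reward (length F) (\<lambda>i. d (map v [0..<Suc i])) v)
        \<partial>(arrival_dist F \<pi>))"

definition expected_opt :: "boxes \<Rightarrow> (nat \<Rightarrow> nat) \<Rightarrow> ennreal" where
  "expected_opt F \<pi> = (SUP d \<in> {d. online_rule (length F) d}. expected_online_reward F \<pi> d)"

text \<open>
  A randomized algorithm draws a seed, independent of the rewards, from a probability space that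
  may depend on \<open>F\<close>. Then \<open>accept A F \<omega> ids vs\<close> is the decision at step \<open>length ids\<close>, given the
  identities \<open>ids\<close> of the previously arrived boxes and the rewards \<open>vs\<close> revealed so far, the
  current one included; hence \<open>vs\<close> is one longer than \<open>ids\<close>. That neither \<open>\<pi>\<close> nor the current
  identity is an argument is what makes the algorithm identity-truthful; the predicate below only
  adds that the seed has a probability law and that the decisions are events.
\<close>

record 'w id_algorithm =
  seed :: "boxes \<Rightarrow> 'w measure"
  accept :: "boxes \<Rightarrow> 'w \<Rightarrow> nat list \<Rightarrow> real list \<Rightarrow> bool"

definition identity_truthful :: "'w id_algorithm \<Rightarrow> bool" where
  "identity_truthful A \<longleftrightarrow>
     (\<forall>F. admissible F \<longrightarrow>
        prob_space (seed A F) \<and>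
        (\<forall>ids. distinct ids \<and> set ids \<subseteq> {..<length F} \<and> length ids < length F \<longrightarrow>
           Measurable.pred (seed A F \<Otimes>\<^sub>M PiM {..<length F} (\<lambda>_. borel))
             (\<lambda>(\<omega>, v). accept A F \<omega> ids (map v [0..<Suc (length ids)]))))"

definition expected_alg :: "'w id_algorithm \<Rightarrow> boxes \<Rightarrow> (nat \<Rightarrow> nat) \<Rightarrow> ennreal" where
  "expected_alg A F \<pi> =
     (\<integral>\<^sup>+ (\<omega>, v). ennreal (obtained_reward (length F)
          (\<lambda>i. accept A F \<omega> (map (inv \<pi>) [0..<i]) (map v [0..<Suc i])) v)
        \<partial>(seed A F \<Otimes>\<^sub>M arrival_dist F \<pi>))"

definition truthfulness_ratio :: "'w id_algorithm \<Rightarrow> ennreal" where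
  "truthfulness_ratio A =
     (INF F \<in> {F. admissible F}. MIN \<pi> \<in> arrival_orders F. expected_alg A F \<pi> / expected_opt F \<pi>)"

end

theory Submission
  imports Defs
begin

text \<open>
  One special box yields \<open>1\<close>, or \<open>1000\<close> with probability \<open>1 / 1000\<close>; the other hundred boxes are
  Bernoulli with success probability \<open>1 / 101\<close> and arrive in a fixed order. The order-aware
  algorithm waits for the special box and obtains \<open>1.999\<close>. A decision-maker who does not know when
  the special box arrives cannot tell its \<open>1\<close> from that of a Bernoulli box: accepting may forfeit the
  chance of \<open>1000\<close>, rejecting may forfeit the last \<open>1\<close>. By Yao's principle it suffices to put
  weights on the arrival times of the special box that make every deterministic rule obtain less
  than \<open>0.81 * 1.999\<close> on average. Until the special box has arrived the revealed identities do not
  depend on its arrival time, so a rule enters only through the probabilities that it is still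
  running, and that it would accept a \<open>1\<close>, along a run of Bernoulli boxes.
\<close>

subsection \<open>The weights of the arrival orders\<close>

text \<open>
  \<open>order_weight p j\<close> is the unnormalised probability that \<open>j\<close> Bernoulli boxes arrive after the
  special box. It is chosen such that a decision-maker seeing a first \<open>1\<close> is indifferent between
  accepting and rejecting at every step; this recursion has the product \<open>growth\<close> as its solution.
\<close>

definition growth :: "real \<Rightarrow> nat \<Rightarrow> real" where
  "growth p j = (\<Prod>i=1..j. 1 + p * ((1 / (1 - p)) ^ i - 1))"

definition order_weight :: "real \<Rightarrow> nat \<Rightarrow> real" where
  "order_weight p j = (if j = 0 then 1 else p * growth p (j - 1) * (1 / (1 - p)) ^ j)"

lemma growth_0 [simp]: "growth p 0 = 1"
  by (simp add: growth_def)

lemma growth_Suc: "growth p (Suc j) = growth p j * (1 + p * ((1 / (1 - p)) ^ Suc j - 1))"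
  by (simp add: growth_def del: power_Suc)

lemma growth_pos:
  assumes "0 \<le> p" "p < 1"
  shows "0 < growth p j"
  unfolding growth_def
proof (rule prod_pos)
  fix i :: nat
  have "1 \<le> (1 / (1 - p)) ^ i"
    using assms by (intro one_le_power) auto
  then show "0 < 1 + p * ((1 / (1 - p)) ^ i - 1)"
    using assms by (intro add_pos_nonneg) auto
qed

lemma order_weight_nonneg: "0 \<le> p \<Longrightarrow> p < 1 \<Longrightarrow> 0 \<le> order_weight p j"
  using growth_pos[of p "j - 1"] by (auto simp: order_weight_def intro!: mult_nonneg_nonneg)

text \<open>By the recursion for \<open>growth\<close>, \<open>order_weight p (Suc j)\<close> equals
  \<open>growth p (Suc j) - growth p j + p * growth p j\<close>; the first two terms
  telescope.\<close>

lemma sum_order_weight: "(\<Sum>j\<le>m. order_weight p j) = growth p m + p * (\<Sum>i<m. growth p i)"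
  by (induction m) (simp_all add: growth_Suc order_weight_def algebra_simps)

text \<open>
  Linear programming duality: \<open>n i\<close> and \<open>q i\<close> stand for the probabilities that a run of Bernoulli
  boxes is not stopped before step \<open>i\<close>, and that in addition a \<open>1\<close> at step \<open>i\<close> would be accepted.
\<close>

lemma weighted_reward_le:
  fixes n q R :: "nat \<Rightarrow> real"
  assumes p: "0 \<le> p" "p < 1" and \<epsilon>: "0 \<le> \<epsilon>" "\<epsilon> \<le> 1"
    and step: "\<And>i. i < N \<Longrightarrow> n (Suc i) \<le> n i - p * q i"
    and q: "\<And>i. i \<le> N \<Longrightarrow> q i \<le> n i"
    and R: "\<And>s. s \<le> N \<Longrightarrow> R s \<le> p * (\<Sum>i<s. q i) + n s
              + (1 - \<epsilon>) * (q s + (n s - q s) * (1 - (1 - p) ^ (N - s)))"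
    and n0: "n 0 \<le> 1"
  shows "(\<Sum>j\<le>N. order_weight p j * R (N - j))
           \<le> p * (\<Sum>i<N. growth p i) + (2 - \<epsilon>) * growth p N"
proof -
  define D where "D = growth p"
  define w where "w = order_weight p"
  define H where "H j = p * (\<Sum>i<j. D i)" for j
  define V where "V j = H j + (2 - \<epsilon>) * D j" for j
  define base where "base s = p * (\<Sum>i<s. q i)" for s
  have D: "0 < D j" for j
    using growth_pos p by (simp add: D_def)
  have V: "0 \<le> V j" for j
  proof -
    have "0 \<le> H j" "0 \<le> (2 - \<epsilon>) * D j"
      using D p \<epsilon> by (auto simp: H_def intro!: mult_nonneg_nonneg sum_nonneg intro: less_imp_le)
    then show ?thesis
      by (simp add: V_def)
  qed
  have w: "0 \<le> w j" for j
    using order_weight_nonneg p by (simp add: w_def)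
  have W: "(\<Sum>i\<le>j. w i) = D j + H j" for j
    by (simp add: w_def D_def H_def sum_order_weight)
  \<comment> \<open>Backward induction; \<open>base (N - j)\<close> is the reward from ones accepted
    before step \<open>N - j\<close>. Over the orders whose special box arrives at step
    \<open>N - j\<close> or later, the weighted reward still to be collected is at most the
    probability of running there times \<open>V j\<close>.\<close>
  have main: "(\<Sum>i\<le>j. w i * (R (N - i) - base (N - j))) \<le> n (N - j) * V j" if "j \<le> N" for j
    using that
  proof (induction j)
    case 0
    have "R N - base N \<le> n N + (1 - \<epsilon>) * q N"
      using R[of N] by (simp add: base_def)
    also have "\<dots> \<le> n N + (1 - \<epsilon>) * n N"
      using q[of N] \<epsilon> by (intro add_left_mono mult_left_mono) auto
    finally show ?case
      by (simp add: w_def V_def H_def D_def order_weight_def algebra_simps)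
  next
    case (Suc j)
    define t where "t = N - Suc j"
    have t: "N - j = Suc t" "N - t = Suc j" "t < N"
      using Suc.prems by (auto simp: t_def)
    have wD: "w (Suc j) * (1 - p) ^ Suc j = p * D j"
      using p by (simp add: w_def order_weight_def D_def power_divide)
    have wDj: "D (Suc j) = D j - p * D j + w (Suc j)"
      by (simp add: w_def order_weight_def D_def growth_Suc algebra_simps)
    have base: "base (Suc t) = base t + p * q t"
      by (simp add: base_def algebra_simps)
    have IH: "(\<Sum>i\<le>j. w i * (R (N - i) - base (Suc t))) \<le> n (Suc t) * V j"
      using Suc t by simp
    \<comment> \<open>Moving back to step \<open>t\<close> lowers the baseline by
      \<open>p * q t\<close>, a gain for each of the orders already summed.\<close>
    have "(\<Sum>i\<le>Suc j. w i * (R (N - i) - base t))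
        = w (Suc j) * (R t - base t) + (\<Sum>i\<le>j. w i * (R (N - i) - base (Suc t)))
          + p * q t * (\<Sum>i\<le>j. w i)"
      by (simp add: base t_def [symmetric] algebra_simps sum.distrib sum_subtractf sum_distrib_left)
    also have "\<dots> \<le> w (Suc j) * (n t + (1 - \<epsilon>) * (q t + (n t - q t) * (1 - (1 - p) ^ Suc j)))
          + (n t - p * q t) * V j + p * q t * (D j + H j)"
    proof -
      have "R t - base t \<le> n t + (1 - \<epsilon>) * (q t + (n t - q t) * (1 - (1 - p) ^ Suc j))"
        using R[of t] t by (simp add: base_def)
      moreover have "n (Suc t) * V j \<le> (n t - p * q t) * V j"
        using step[of t] t V by (intro mult_right_mono) auto
      ultimately show ?thesis
        unfolding W using IH w[of "Suc j"] by (intro add_mono mult_left_mono order.refl) auto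
    qed
    also have "\<dots> = n t * (w (Suc j) * (2 - \<epsilon>)) - (1 - \<epsilon>) * (n t - q t) * (w (Suc j) * (1 - p) ^ Suc j)
          + (n t - p * q t) * V j + p * q t * (D j + H j)"
      by (simp add: algebra_simps del: power_Suc)
    \<comment> \<open>By \<open>wD\<close> the terms with \<open>q t\<close> cancel: this is the
      indifference between accepting and rejecting. What remains is a multiple of
      \<open>n t\<close>.\<close>
    also have "\<dots> = n t * V (Suc j)"
      unfolding wD V_def wDj by (simp add: H_def algebra_simps)
    finally show ?case
      by (simp add: t_def)
  qed
  have "n 0 * V N \<le> 1 * V N"
    using n0 V by (intro mult_right_mono) auto
  with main[of N] show ?thesis
    by (simp add: base_def V_def H_def D_def w_def)
qed

text \<open>
  Fixed-point arithmetic with eight digits: an upper bound for the powers of \<open>1 / (1 - p)\<close> and a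
  lower bound for \<open>(\<Sum>i<j. growth p i) / growth p j\<close>, at \<open>p = 1 / 101\<close>.
\<close>

primrec growth_cert :: "nat \<Rightarrow> int \<times> int" where
  "growth_cert 0 = (100000000, 0)"
| "growth_cert (Suc j) = (let (g, s) = growth_cert j; g' = g * 101 div 100 + 1 in
     (g', (s + 100000000) * 100000000 div (100000000 + ((g' - 100000000) div 101 + 1))))"

text \<open>The ratio \<open>r\<close> of the sum to \<open>growth\<close> obeys
  \<open>r' = (r + 1) / f\<close>, where \<open>f\<close> is the next factor of
  \<open>growth\<close>. All rounding is on the safe side: powers, and with them \<open>f\<close>,
  are rounded up, the quotient down.\<close>

lemma growth_cert_bounds:
  fixes p :: real
  defines "p \<equiv> 1 / 101"
  shows "10 ^ 8 * (1 / (1 - p)) ^ j \<le> of_int (fst (growth_cert j)) \<and>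
     of_int (snd (growth_cert j)) * growth p j \<le> 10 ^ 8 * (\<Sum>i<j. growth p i) \<and>
     0 \<le> snd (growth_cert j)"
proof (induction j)
  case (Suc j)
  obtain g s where gs: "growth_cert j = (g, s)"
    by fastforce
  define g' where "g' = g * 101 div 100 + 1"
  define d where "d = 100000000 + ((g' - 100000000) div 101 + 1)"
  have *: "growth_cert (Suc j) = (g', (s + 100000000) * 100000000 div d)"
    by (simp add: gs g'_def d_def Let_def)
  have IH: "10 ^ 8 * (1 / (1 - p)) ^ j \<le> of_int g" "of_int s * growth p j \<le> 10 ^ 8 * (\<Sum>i<j. growth p i)" "0 \<le> s"
    using Suc by (auto simp: gs)
  have ratio: "1 / (1 - p) = 101 / 100"
    by (simp add: p_def)
  have "real_of_int g * 101 / 100 \<le> of_int g'"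
    using real_of_int_div4[of "g * 101" 100] real_of_int_div3[of "g * 101" 100]
    by (simp add: g'_def)
  then have 1: "10 ^ 8 * (1 / (1 - p)) ^ Suc j \<le> of_int g'"
    using IH(1) unfolding ratio by simp
  have "real_of_int (g' - 100000000) / 101 \<le> of_int ((g' - 100000000) div 101 + 1)"
    using real_of_int_div3[of "g' - 100000000" 101] by simp
  then have d: "10 ^ 8 * (1 + p * ((1 / (1 - p)) ^ Suc j - 1)) \<le> of_int d"
  proof -
    have "10 ^ 8 * (1 + p * (x - 1)) \<le> of_int d" if "10 ^ 8 * x \<le> of_int g'" for x :: real
      using that \<open>real_of_int (g' - 100000000) / 101 \<le> _\<close> by (simp add: d_def p_def)
    then show ?thesis
      using 1 by blast
  qed
  have pow: "1 \<le> (1 / (1 - p)) ^ Suc j"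
    unfolding ratio by (intro one_le_power) simp
  have "0 \<le> p"
    by (simp add: p_def)
  then have "1 \<le> 1 + p * ((1 / (1 - p)) ^ Suc j - 1)"
    using pow by simp
  then have "0 < real_of_int d"
    by (intro less_le_trans[OF _ d]) (simp del: power_Suc)
  then have d0: "0 < d"
    by simp
  have D: "0 < growth p j" "0 < growth p (Suc j)"
    by (simp_all add: growth_pos p_def)
  define s' where "s' = (s + 100000000) * 100000000 div d"
  have s'0: "0 \<le> s'"
    using IH(3) d0 by (simp add: s'_def pos_imp_zdiv_nonneg_iff)
  have "s' * d \<le> (s + 100000000) * 100000000"
    using d0 div_mult_mod_eq[of "(s + 100000000) * 100000000" d]
      pos_mod_sign[of d "(s + 100000000) * 100000000"] unfolding s'_def by linarith
  then have "of_int s' * real_of_int d \<le> of_int ((s + 100000000) * 100000000)"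
    by (metis of_int_le_iff of_int_mult)
  moreover define f where "f = 1 + p * ((1 / (1 - p)) ^ Suc j - 1)"
  have "of_int s' * (10 ^ 8 * f) \<le> of_int s' * real_of_int d"
    using d s'0 by (intro mult_left_mono) (auto simp: f_def)
  ultimately have "of_int s' * f \<le> of_int s + 10 ^ 8"
    by simp
  then have "of_int s' * f * growth p j \<le> (of_int s + 10 ^ 8) * growth p j"
    using D by (intro mult_right_mono) auto
  also have "\<dots> \<le> 10 ^ 8 * (\<Sum>i<Suc j. growth p i)"
    using IH(2) by (simp add: algebra_simps)
  finally have "of_int s' * growth p (Suc j) \<le> 10 ^ 8 * (\<Sum>i<Suc j. growth p i)"
    by (simp add: growth_Suc f_def [symmetric] mult_ac del: power_Suc)
  with 1 s'0 show ?case
    unfolding * by (simp add: s'_def del: power_Suc sum.lessThan_Suc)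
qed simp

text \<open>In units of \<open>1 / 10 ^ 8\<close> this is the ratio 62, which is just enough: the
  next inequality needs a ratio above roughly 61.95.\<close>

lemma growth_cert_100: "6200000000 \<le> snd (growth_cert 100)"
  by code_simp

text \<open>The left side is the bound of \<open>weighted_reward_le\<close>, and
  \<open>2 - \<epsilon>\<close> is the benchmark 1.999. After division by
  \<open>growth p 100\<close> only the certified ratio matters, and a larger one helps because
  \<open>0.81 * (2 - \<epsilon>)\<close> exceeds 1.\<close>

lemma weighted_reward_bound_less:
  fixes p \<epsilon> :: real
  defines "p \<equiv> 1 / 101" and "\<epsilon> \<equiv> 1 / 1000"
  shows "p * (\<Sum>i<100. growth p i) + (2 - \<epsilon>) * growth p 100
           < 0.81 * (2 - \<epsilon>) * (\<Sum>j\<le>100. order_weight p j)"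
proof -
  have D: "0 < growth p 100"
    by (simp add: growth_pos p_def)
  have "6200000000 * growth p 100 \<le> of_int (snd (growth_cert 100)) * growth p 100"
    using D growth_cert_100 by (intro mult_right_mono) auto
  also have "\<dots> \<le> 10 ^ 8 * (\<Sum>i<100. growth p i)"
    using growth_cert_bounds[of 100] by (simp add: p_def)
  finally have "62 * growth p 100 \<le> (\<Sum>i<100. growth p i)"
    by simp
  then show ?thesis
    using D unfolding sum_order_weight by (simp add: p_def \<epsilon>_def)
qed

subsection \<open>A stopping rule facing independent Bernoulli rewards\<close>

definition two_point :: "real \<Rightarrow> real \<Rightarrow> real \<Rightarrow> real measure" where
  "two_point q x y = distr (measure_pmf (bernoulli_pmf q)) borel (\<lambda>b. if b then x else y)"

lemma sets_two_point [simp, measurable_cong]: "sets (two_point q x y) = sets borel"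
  by (simp add: two_point_def)

lemma space_two_point [simp]: "space (two_point q x y) = UNIV"
  by (simp add: two_point_def)

lemma prob_space_two_point: "prob_space (two_point q x y)"
  unfolding two_point_def by (intro measure_pmf.prob_space_distr) simp

lemma nn_integral_two_point:
  assumes "0 \<le> q" "q \<le> 1" "f \<in> borel_measurable borel"
  shows "(\<integral>\<^sup>+z. f z \<partial>two_point q x y) = ennreal q * f x + ennreal (1 - q) * f y"
  using assms by (simp add: two_point_def nn_integral_distr mult.commute)

lemma AE_two_point: "AE z in two_point q x y. z = x \<or> z = y"
  unfolding two_point_def by (subst AE_distr_iff) auto

lemma AE_two_pointI: "Q x \<Longrightarrow> Q y \<Longrightarrow> AE z in two_point q x y. Q z"
  using AE_two_point by (rule eventually_mono) auto

lemma measurable_PiM_upd_const: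
  assumes "i \<in> I"
  shows "(\<lambda>v. v(i := y)) \<in> PiM I (\<lambda>_. borel) \<rightarrow>\<^sub>M PiM I (\<lambda>_. borel :: real measure)"
  using assms by (intro measurable_fun_upd[where J = I]) auto

text \<open>
  The coordinate \<open>s\<close> of the right-hand measure is a dummy that is overwritten. This places all
  arrival orders on one probability space and also yields independence of a single coordinate.
\<close>

lemma nn_integral_PiM_resample:
  fixes f :: "('i \<Rightarrow> real) \<Rightarrow> ennreal"
  assumes I: "finite I" "s \<in> I" and prob: "prob_space A" "prob_space B"
    and [measurable_cong]: "sets A = sets borel" "sets B = sets borel"
    and f: "f \<in> borel_measurable (PiM I (\<lambda>_. borel))"
  shows "(\<integral>\<^sup>+v. f v \<partial>PiM I (\<lambda>i. if i = s then A else B))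
       = (\<integral>\<^sup>+v. \<integral>\<^sup>+y. f (v(s := y)) \<partial>A \<partial>PiM I (\<lambda>_. B))"
proof -
  interpret A: prob_space A by fact
  interpret B: prob_space B by fact
  define J where "J = I - {s}"
  have J: "finite J" "s \<notin> J" "insert s J = I"
    using I by (auto simp: J_def)
  interpret X: product_prob_space "\<lambda>i. if i = s then A else B"
    by (intro product_prob_spaceI) (simp add: prob)
  interpret Y: product_prob_space "\<lambda>_. B" I
    by (intro product_prob_spaceI) (simp add: prob)
  have sets1: "sets (PiM I (\<lambda>i. if i = s then A else B)) = sets (PiM I (\<lambda>_. borel))"
    by (intro sets_PiM_cong) (auto simp: assms)
  have sets2: "sets (PiM I (\<lambda>_. B)) = sets (PiM I (\<lambda>_. borel))"
    by (intro sets_PiM_cong) (auto simp: assms)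
  have f1: "f \<in> borel_measurable (PiM (insert s J) (\<lambda>i. if i = s then A else B))"
    using f unfolding J measurable_cong_sets[OF sets1 refl] .
  have "(\<lambda>(v, y). v(s := y)) \<in> PiM I (\<lambda>_. borel :: real measure) \<Otimes>\<^sub>M borel \<rightarrow>\<^sub>M PiM I (\<lambda>_. borel)"
    unfolding split_beta' using I(2)
    by (intro measurable_fun_upd[where J = I] measurable_fst measurable_snd) auto
  then have upd: "(\<lambda>(v, y). v(s := y)) \<in> PiM I (\<lambda>_. B) \<Otimes>\<^sub>M A \<rightarrow>\<^sub>M PiM I (\<lambda>_. borel)"
    unfolding measurable_cong_sets[OF sets_pair_measure_cong[OF sets2 assms(5)] refl] .
  have g: "(\<lambda>v. \<integral>\<^sup>+y. f (v(s := y)) \<partial>A) \<in> borel_measurable (PiM (insert s J) (\<lambda>_. B))"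
    using A.borel_measurable_nn_integral_fst[OF measurable_compose[OF upd f]] by (simp add: J)
  have "(\<integral>\<^sup>+v. f v \<partial>PiM I (\<lambda>i. if i = s then A else B))
      = (\<integral>\<^sup>+v. \<integral>\<^sup>+y. f (v(s := y)) \<partial>A \<partial>PiM J (\<lambda>i. if i = s then A else B))"
    using X.product_nn_integral_insert[OF J(1,2) f1] by (simp add: J(3))
  also have "PiM J (\<lambda>i. if i = s then A else B) = PiM J (\<lambda>_. B)"
    using J(2) by (intro PiM_cong) auto
  \<comment> \<open>The inner integral ignores coordinate \<open>s\<close> of \<open>v\<close>, so a
    further coordinate of total mass one may be integrated out there.\<close>
  also have "(\<integral>\<^sup>+v. \<integral>\<^sup>+y. f (v(s := y)) \<partial>A \<partial>PiM J (\<lambda>_. B))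
      = (\<integral>\<^sup>+v. \<integral>\<^sup>+y. f (v(s := y)) \<partial>A \<partial>PiM I (\<lambda>_. B))"
    using Y.product_nn_integral_insert[OF J(1,2) g] by (simp add: J(3) B.emeasure_space_1)
  finally show ?thesis .
qed

text \<open>Besides the \<open>N\<close> Bernoulli boxes there is the special one, hence
  \<open>Suc N\<close> steps. Until it has arrived, the past identities are the same in all orders
  considered, so they are absorbed into \<open>rule_at\<close>.\<close>

locale stopping_rule =
  fixes N :: nat and p :: real and rule_at :: "nat \<Rightarrow> real list \<Rightarrow> bool"
  assumes p_nonneg: "0 \<le> p" and p_le_1: "p \<le> 1"
    and rule_at_measurable:
      "i \<le> N \<Longrightarrow> Measurable.pred (PiM {..<Suc N} (\<lambda>_. borel)) (\<lambda>v. rule_at i (map v [0..<Suc i]))"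
begin

definition stops :: "nat \<Rightarrow> (nat \<Rightarrow> real) \<Rightarrow> bool" where
  "stops i v \<longleftrightarrow> rule_at i (map v [0..<Suc i])"

definition running :: "nat \<Rightarrow> (nat \<Rightarrow> real) \<Rightarrow> bool" where
  "running i v \<longleftrightarrow> (\<forall>j<i. \<not> stops j v)"

text \<open>Asking about a hypothetical \<open>1\<close> makes the predicate independent of the
  actual reward at step \<open>i\<close>.\<close>

definition takes_one :: "nat \<Rightarrow> (nat \<Rightarrow> real) \<Rightarrow> bool" where
  "takes_one i v \<longleftrightarrow> stops i (v(i := 1))"

definition P :: "(nat \<Rightarrow> real) measure" where
  "P = PiM {..<Suc N} (\<lambda>_. two_point p 1 0)"

text \<open>Together with \<open>take_prob\<close> this supplies \<open>n\<close> and
  \<open>q\<close> of \<open>weighted_reward_le\<close>. Neither mentions the arrival time of the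
  special box, so one pair serves all orders.\<close>

definition run_prob :: "nat \<Rightarrow> real" where
  "run_prob i = \<P>(v in P. running i v)"

definition take_prob :: "nat \<Rightarrow> real" where
  "take_prob i = \<P>(v in P. running i v \<and> takes_one i v)"

sublocale P: prob_space P
  unfolding P_def by (intro prob_space_PiM prob_space_two_point)

lemma sets_P [measurable_cong]: "sets P = sets (PiM {..<Suc N} (\<lambda>_. borel))"
  unfolding P_def by (intro sets_PiM_cong) auto

lemma stops_upd [simp]: "i < k \<Longrightarrow> stops i (v(k := y)) = stops i v"
  unfolding stops_def by (intro arg_cong[where f = "rule_at i"]) auto

lemma running_upd [simp]: "i \<le> k \<Longrightarrow> running i (v(k := y)) = running i v"
  by (auto simp: running_def)

lemma takes_one_upd [simp]: "i \<le> k \<Longrightarrow> takes_one i (v(k := y)) = takes_one i v"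
proof -
  assume "i \<le> k"
  then have "map ((v(k := y))(i := 1)) [0..<Suc i] = map (v(i := 1)) [0..<Suc i]"
    by auto
  then show ?thesis
    by (simp only: takes_one_def stops_def)
qed

lemma stops_measurable:
  "i \<le> N \<Longrightarrow> Measurable.pred (PiM {..<Suc N} (\<lambda>_. borel)) (stops i)"
  using rule_at_measurable[of i] by (simp add: stops_def[abs_def])

lemma running_measurable:
  assumes "i \<le> Suc N"
  shows "Measurable.pred (PiM {..<Suc N} (\<lambda>_. borel)) (running i)"
proof -
  have "Measurable.pred (PiM {..<Suc N} (\<lambda>_. borel)) (\<lambda>v. \<forall>j\<in>{..<i}. \<not> stops j v)"
    using assms by (intro pred_intros_finite pred_intros_logic stops_measurable) auto
  moreover have "running i = (\<lambda>v. \<forall>j\<in>{..<i}. \<not> stops j v)"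
    by (auto simp: running_def)
  ultimately show ?thesis
    by (simp only:)
qed

lemma takes_one_measurable:
  assumes "i \<le> N"
  shows "Measurable.pred (PiM {..<Suc N} (\<lambda>_. borel)) (takes_one i)"
proof -
  have "i \<in> {..<Suc N}"
    using assms by simp
  from measurable_compose[OF measurable_PiM_upd_const[OF this] stops_measurable[OF assms]]
  show ?thesis
    unfolding takes_one_def[abs_def] .
qed

lemma nn_integral_indicator_P:
  "Measurable.pred (PiM {..<Suc N} (\<lambda>_. borel)) Q \<Longrightarrow>
     (\<integral>\<^sup>+v. indicator {v. Q v} v \<partial>P) = ennreal (\<P>(v in P. Q v))"
proof -
  assume [measurable]: "Measurable.pred (PiM {..<Suc N} (\<lambda>_. borel)) Q"
  have "(\<integral>\<^sup>+v. indicator {v. Q v} v \<partial>P) = (\<integral>\<^sup>+v. indicator {v \<in> space P. Q v} v \<partial>P)"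
    by (intro nn_integral_cong) (auto simp: indicator_def)
  also have "\<dots> = emeasure P {v \<in> space P. Q v}"
    by (intro nn_integral_indicator) measurable
  finally show ?thesis
    by (simp add: P.emeasure_eq_measure)
qed

text \<open>Resampling coordinate \<open>i\<close> from its own law preserves \<open>P\<close> and
  does not affect \<open>Q\<close>, so the integral factorises.\<close>

lemma prob_P_coordinate:
  assumes i: "i \<le> N" and Q[measurable]: "Measurable.pred (PiM {..<Suc N} (\<lambda>_. borel)) Q"
    and upd: "\<And>v y. Q (v(i := y)) = Q v"
  shows "\<P>(v in P. Q v \<and> v i = 1) = p * \<P>(v in P. Q v)"
    and "\<P>(v in P. Q v \<and> v i = 0) = (1 - p) * \<P>(v in P. Q v)"
proof -
  have *: "ennreal (\<P>(v in P. Q v \<and> v i = z))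
      = (\<integral>\<^sup>+y. indicator {z} y \<partial>two_point p 1 0) * ennreal (\<P>(v in P. Q v))" for z
  proof -
    have [measurable]: "(\<lambda>v. v i) \<in> PiM {..<Suc N} (\<lambda>_. borel) \<rightarrow>\<^sub>M (borel :: real measure)"
      using i by (intro measurable_component_singleton) auto
    let ?f = "\<lambda>v. indicator {v. Q v \<and> v i = z} v :: ennreal"
    have f: "?f \<in> borel_measurable (PiM {..<Suc N} (\<lambda>_. borel))"
      by measurable
    have "ennreal (\<P>(v in P. Q v \<and> v i = z)) = (\<integral>\<^sup>+v. ?f v \<partial>P)"
      by (intro nn_integral_indicator_P[symmetric]) measurable
    also have "\<dots> = (\<integral>\<^sup>+v. \<integral>\<^sup>+y. ?f (v(i := y)) \<partial>two_point p 1 0 \<partial>P)"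
      using nn_integral_PiM_resample[of "{..<Suc N}" i "two_point p 1 0" "two_point p 1 0" ?f] i f
      by (simp add: P_def prob_space_two_point del: lessThan_Suc)
    also have "\<dots> = (\<integral>\<^sup>+v. \<integral>\<^sup>+y. indicator {v. Q v} v * indicator {z} y \<partial>two_point p 1 0 \<partial>P)"
      by (intro nn_integral_cong) (auto simp: indicator_def upd)
    also have "\<dots> = (\<integral>\<^sup>+v. indicator {v. Q v} v \<partial>P) * (\<integral>\<^sup>+y. indicator {z} y \<partial>two_point p 1 0)"
      by (simp add: nn_integral_cmult nn_integral_multc)
    finally show ?thesis
      by (simp add: nn_integral_indicator_P mult.commute)
  qed
  show "\<P>(v in P. Q v \<and> v i = 1) = p * \<P>(v in P. Q v)"
    using *[of 1] p_nonneg p_le_1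
    by (simp add: nn_integral_two_point ennreal_mult[symmetric] del: nn_integral_indicator)
  show "\<P>(v in P. Q v \<and> v i = 0) = (1 - p) * \<P>(v in P. Q v)"
    using *[of 0] p_nonneg p_le_1
    by (simp add: nn_integral_two_point ennreal_mult[symmetric] del: nn_integral_indicator)
qed

text \<open>Zeros are appended one at a time: the event with zeros up to \<open>k\<close> does not
  involve coordinate \<open>Suc k\<close>.\<close>

lemma prob_P_zero_tail:
  assumes i: "i \<le> k" "k \<le> N" and Q[measurable]: "Measurable.pred (PiM {..<Suc N} (\<lambda>_. borel)) Q"
    and upd: "\<And>v j y. i < j \<Longrightarrow> Q (v(j := y)) = Q v"
  shows "\<P>(v in P. Q v \<and> (\<forall>j\<in>{i<..k}. v j = 0)) = (1 - p) ^ (k - i) * \<P>(v in P. Q v)"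
  using i
proof (induction k rule: dec_induct)
  case base
  show ?case
    by simp
next
  case (step k)
  let ?Q = "\<lambda>v. Q v \<and> (\<forall>j\<in>{i<..k}. v j = 0)"
  have comp: "j \<in> {i<..k} \<Longrightarrow> (\<lambda>v. v j) \<in> PiM {..<Suc N} (\<lambda>_. borel) \<rightarrow>\<^sub>M (borel :: real measure)" for j
    using step by (intro measurable_component_singleton) auto
  have "Measurable.pred (PiM {..<Suc N} (\<lambda>_. borel)) (\<lambda>v. v j = (0::real))" if "j \<in> {i<..k}" for j
    using borel_measurable_eq[OF comp[OF that] borel_measurable_const, of 0]
    by (simp add: Measurable.pred_def)
  then have Q': "Measurable.pred (PiM {..<Suc N} (\<lambda>_. borel)) ?Q"
    by (intro pred_intros_logic pred_intros_finite Q) auto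
  then have "\<P>(v in P. ?Q v \<and> v (Suc k) = 0) = (1 - p) * \<P>(v in P. ?Q v)"
    using step upd by (intro prob_P_coordinate(2) Q') auto
  moreover have "(Q v \<and> (\<forall>j\<in>{i<..Suc k}. v j = 0)) = (?Q v \<and> v (Suc k) = 0)" for v
    using step by (auto simp: le_Suc_eq)
  ultimately show ?case
    using step by (simp only: Suc_diff_le power_Suc mult.assoc)
qed

lemma run_prob_0: "run_prob 0 = 1"
  by (simp add: run_prob_def running_def P.prob_space)

lemma take_prob_le_run_prob:
  assumes "i \<le> N"
  shows "take_prob i \<le> run_prob i"
proof -
  note [measurable] = running_measurable[OF le_SucI[OF assms]]
  show ?thesis
    unfolding take_prob_def run_prob_def by (intro P.finite_measure_mono) auto
qed

text \<open>Where \<open>v i = 1\<close>, stopping coincides with \<open>takes_one i\<close>, which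
  no longer depends on coordinate \<open>i\<close>.\<close>

lemma prob_stop_at_one:
  assumes "i \<le> N"
  shows "\<P>(v in P. running i v \<and> stops i v \<and> v i = 1) = p * take_prob i"
proof -
  note [measurable] = running_measurable[OF le_SucI[OF assms]] takes_one_measurable[OF assms]
  have "takes_one i v = stops i v" if "v i = 1" for v
    unfolding takes_one_def fun_upd_idem[of v i, OF that] ..
  then have *: "(running i v \<and> stops i v \<and> v i = 1) = ((running i v \<and> takes_one i v) \<and> v i = 1)" for v
    by (cases "v i = 1") simp_all
  have "\<P>(v in P. running i v \<and> stops i v \<and> v i = 1)
           = \<P>(v in P. (running i v \<and> takes_one i v) \<and> v i = 1)"
    by (simp only: *)
  also have "\<dots> = p * take_prob i"
    unfolding take_prob_def using assms by (intro prob_P_coordinate(1)) auto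
  finally show ?thesis .
qed

text \<open>Stopping at a \<open>1\<close> is one way to end the run; equality can fail because a
  rule may also stop at a \<open>0\<close>.\<close>

lemma run_prob_Suc_le:
  assumes "i < N"
  shows "run_prob (Suc i) \<le> run_prob i - p * take_prob i"
proof -
  have [measurable]: "(\<lambda>v. v i) \<in> PiM {..<Suc N} (\<lambda>_. borel) \<rightarrow>\<^sub>M (borel :: real measure)"
    using assms by (intro measurable_component_singleton) auto
  have i: "i \<le> N" "i \<le> Suc N" "Suc i \<le> Suc N"
    using assms by auto
  note [measurable] = running_measurable[OF i(2)] running_measurable[OF i(3)] stops_measurable[OF i(1)]
  let ?A = "{v \<in> space P. running (Suc i) v}"
  let ?B = "{v \<in> space P. running i v \<and> stops i v \<and> v i = 1}"
  let ?C = "{v \<in> space P. running i v}"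
  have sets: "?A \<in> sets P" "?B \<in> sets P" "?C \<in> sets P"
    by measurable
  have disjoint: "?A \<inter> ?B = {}" and sub: "?A \<union> ?B \<subseteq> ?C"
    unfolding running_def by auto
  have "measure P ?A + measure P ?B = measure P (?A \<union> ?B)"
    by (rule P.finite_measure_Union[OF sets(1,2) disjoint, symmetric])
  also have "\<dots> \<le> measure P ?C"
    by (rule P.finite_measure_mono[OF sub sets(3)])
  finally have "measure P ?A + measure P ?B \<le> measure P ?C" .
  then show ?thesis
    by (simp add: run_prob_def prob_stop_at_one[OF i(1)])
qed

text \<open>Among the runs reaching step \<open>s\<close>, the complement is that a \<open>1\<close>
  there would be rejected and all later rewards vanish. The event describes when a \<open>1\<close>
  can still be obtained if the special box yields \<open>1\<close>.\<close>

lemma prob_take_or_later_one: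
  assumes s: "s \<le> N"
  shows "\<P>(v in P. running s v \<and> (takes_one s v \<or> (\<exists>j\<in>{s<..N}. v j \<noteq> 0)))
       = take_prob s + (run_prob s - take_prob s) * (1 - (1 - p) ^ (N - s))"
proof -
  have s': "s \<le> Suc N"
    using s by simp
  note [measurable] = running_measurable[OF s'] takes_one_measurable[OF s]
  let ?skip = "\<lambda>v. running s v \<and> \<not> takes_one s v"
  have zero: "Measurable.pred (PiM {..<Suc N} (\<lambda>_. borel)) (\<lambda>v. \<forall>j\<in>{s<..N}. v j = (0::real))"
  proof (intro pred_intros_finite)
    fix j assume "j \<in> {s<..N}"
    then have "(\<lambda>v. v j) \<in> PiM {..<Suc N} (\<lambda>_. borel) \<rightarrow>\<^sub>M (borel :: real measure)"
      by (intro measurable_component_singleton) auto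
    from borel_measurable_eq[OF this borel_measurable_const, of 0]
    show "Measurable.pred (PiM {..<Suc N} (\<lambda>_. borel)) (\<lambda>v. v j = (0::real))"
      by (simp add: Measurable.pred_def)
  qed simp
  note [measurable] = zero
  have skip: "\<P>(v in P. ?skip v) = run_prob s - take_prob s"
  proof -
    have "\<P>(v in P. ?skip v) = measure P ({v \<in> space P. running s v} - {v \<in> space P. running s v \<and> takes_one s v})"
      by (intro arg_cong[where f = "measure P"]) auto
    also have "\<dots> = run_prob s - take_prob s"
      unfolding run_prob_def take_prob_def by (intro P.finite_measure_Diff) auto
    finally show ?thesis .
  qed
  have "\<P>(v in P. ?skip v \<and> (\<forall>j\<in>{s<..N}. v j = 0)) = (1 - p) ^ (N - s) * \<P>(v in P. ?skip v)"
    using s by (intro prob_P_zero_tail) auto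
  moreover have "\<P>(v in P. running s v \<and> (takes_one s v \<or> (\<exists>j\<in>{s<..N}. v j \<noteq> 0)))
      = measure P ({v \<in> space P. running s v} - {v \<in> space P. ?skip v \<and> (\<forall>j\<in>{s<..N}. v j = 0)})"
    by (intro arg_cong[where f = "measure P"]) auto
  moreover have "\<dots> = run_prob s - \<P>(v in P. ?skip v \<and> (\<forall>j\<in>{s<..N}. v j = 0))"
    unfolding run_prob_def by (intro P.finite_measure_Diff) auto
  ultimately show ?thesis
    by (simp add: skip algebra_simps)
qed

end

section \<open>Reward of a rule when the special box arrives at step \<open>s\<close>\<close>

context stopping_rule
begin

text \<open>Only the decisions up to step \<open>s\<close> are tied to the rule, since later ones
  may use the identity of the special box. The bound is therefore generous: a run that meets
  \<open>M\<close> is granted \<open>M\<close>, and a rejected \<open>1\<close> is replaced by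
  \<open>1\<close> whenever some later reward is nonzero.\<close>

lemma obtained_reward_le:
  assumes s: "s \<le> N" and M: "1 < M"
    and c: "\<And>i. i \<le> s \<Longrightarrow> c i \<longleftrightarrow> stops i v"
    and v: "\<And>j. j \<le> N \<Longrightarrow> j \<noteq> s \<Longrightarrow> v j = 1 \<or> v j = 0" and vs: "v s = M \<or> v s = 1"
  shows "ennreal (obtained_reward (Suc N) c v)
     \<le> (\<Sum>i<s. indicator {v. running i v \<and> stops i v \<and> v i = 1} v)
       + indicator {v. running s v} v *
         (if v s = 1 then indicator {v. stops s v \<or> (\<exists>j\<in>{s<..N}. v j \<noteq> 0)} v else ennreal M)"
    (is "_ \<le> ?early + ?late")
proof (cases "\<exists>i<Suc N. c i")
  case True
  define t where "t = (LEAST i. i < Suc N \<and> c i)"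
  have t: "t < Suc N" "c t"
    using LeastI_ex[of "\<lambda>i. i < Suc N \<and> c i"] True by (auto simp: t_def)
  have before: "\<not> c j" if "j < t" for j
    using not_less_Least[of j "\<lambda>i. i < Suc N \<and> c i"] that t by (auto simp: t_def)
  have reward: "obtained_reward (Suc N) c v = v t"
    using True by (simp add: obtained_reward_def t_def)
  consider "t < s" | "t = s" | "s < t"
    by linarith
  then show ?thesis
  proof cases
    case 1
    have "running t v" "stops t v"
      using before 1 c t by (auto simp: running_def)
    then have "ennreal (v t) \<le> indicator {v. running t v \<and> stops t v \<and> v t = 1} v"
      using v[of t] 1 t by auto
    also have "\<dots> \<le> ?early"
      using 1 by (intro member_le_sum) auto
    finally show ?thesis
      by (simp add: reward add_increasing2)
  next
    case 2
    have "running s v" "stops s v"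
      using before 2 c t by (auto simp: running_def)
    then have "ennreal (v t) \<le> ?late"
      using vs M 2 by auto
    then show ?thesis
      by (simp add: reward add_increasing)
  next
    case 3
    have "running s v"
      using before 3 c by (auto simp: running_def)
    moreover have "v t = 1 \<or> v t = 0"
      using v[of t] 3 t by auto
    moreover have "v t = 1 \<Longrightarrow> \<exists>j\<in>{s<..N}. v j \<noteq> 0"
      using 3 t by (intro bexI[of _ t]) auto
    ultimately have "ennreal (v t) \<le> ?late"
      using M by auto
    then show ?thesis
      by (simp add: reward add_increasing)
  qed
next
  case False
  then have "obtained_reward (Suc N) c v = 0"
    unfolding obtained_reward_def by (rule if_not_P)
  then show ?thesis
    by (simp only: ennreal_0 zero_le)
qed

text \<open>For \<open>\<epsilon> * M = 1\<close> the bound has the form required of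
  \<open>R\<close> in \<open>weighted_reward_le\<close>.\<close>

lemma expected_reward_le:
  assumes s: "s \<le> N" and M: "1 < M" and \<epsilon>: "0 \<le> \<epsilon>" "\<epsilon> \<le> 1"
    and c: "\<And>i v. i \<le> s \<Longrightarrow> c i v \<longleftrightarrow> stops i v"
  shows "(\<integral>\<^sup>+v. ennreal (obtained_reward (Suc N) (\<lambda>i. c i v) v)
            \<partial>PiM {..<Suc N} (\<lambda>i. if i = s then two_point \<epsilon> M 1 else two_point p 1 0))
     \<le> ennreal (p * (\<Sum>i<s. take_prob i) + \<epsilon> * M * run_prob s
          + (1 - \<epsilon>) * (take_prob s + (run_prob s - take_prob s) * (1 - (1 - p) ^ (N - s))))"
proof -
  let ?X = "PiM {..<Suc N} (\<lambda>i. if i = s then two_point \<epsilon> M 1 else two_point p 1 0)"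
  let ?E = "PiM {..<Suc N} (\<lambda>_. borel :: real measure)"
  let ?early = "\<lambda>i v. indicator {v. running i v \<and> stops i v \<and> v i = 1} v :: ennreal"
  let ?run = "\<lambda>v. indicator {v. running s v} v :: ennreal"
  let ?win = "\<lambda>v. indicator {v. running s v \<and> (takes_one s v \<or> (\<exists>j\<in>{s<..N}. v j \<noteq> 0))} v :: ennreal"
  define f where "f v = (\<Sum>i<s. ?early i v) + ?run v *
         (if v s = 1 then indicator {v. stops s v \<or> (\<exists>j\<in>{s<..N}. v j \<noteq> 0)} v else ennreal M)" for v
  have comp: "(\<lambda>v. v j) \<in> ?E \<rightarrow>\<^sub>M (borel :: real measure)" if "j \<le> N" for j
    using that by (intro measurable_component_singleton) auto
  have eq: "Measurable.pred ?E (\<lambda>v. v j = a)" if "j \<le> N" for j and a :: real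
    using borel_measurable_eq[OF comp[OF that] borel_measurable_const, of a]
    by (simp add: Measurable.pred_def)
  have tail: "Measurable.pred ?E (\<lambda>v. \<exists>j\<in>{s<..N}. v j \<noteq> 0)"
    by (intro pred_intros_finite pred_intros_logic eq) auto
  have run: "Measurable.pred ?E (running i)" "Measurable.pred ?E (stops i)" "Measurable.pred ?E (takes_one i)"
    if "i \<le> s" for i
    using that s by (auto intro!: running_measurable stops_measurable takes_one_measurable)
  have early: "Measurable.pred ?E (\<lambda>v. running i v \<and> stops i v \<and> v i = 1)" if "i < s" for i
    using that s by (intro pred_intros_logic run eq) auto
  have win: "Measurable.pred ?E (\<lambda>v. running s v \<and> (takes_one s v \<or> (\<exists>j\<in>{s<..N}. v j \<noteq> 0)))"
    by (intro pred_intros_logic run tail) auto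
  have ind: "(\<lambda>v. indicator {v. Q v} v :: ennreal) \<in> borel_measurable ?E" if "Measurable.pred ?E Q" for Q
    using that by measurable
  have f_meas: "f \<in> borel_measurable ?E"
    unfolding f_def[abs_def] using s
    by (intro borel_measurable_add borel_measurable_sum borel_measurable_times_ennreal measurable_If
        ind early run eq pred_intros_logic tail borel_measurable_const) auto
  have "AE v in ?X. \<forall>j\<in>{..<Suc N}. if j = s then v j = M \<or> v j = 1 else v j = 1 \<or> v j = 0"
  proof (intro AE_finite_allI)
    fix j assume j: "j \<in> {..<Suc N}"
    have *: "AE x in (if j = s then two_point \<epsilon> M 1 else two_point p 1 0).
        if j = s then x = M \<or> x = 1 else x = 1 \<or> x = 0"
      using AE_two_point by auto
    show "AE v in ?X. if j = s then v j = M \<or> v j = 1 else v j = 1 \<or> v j = 0"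
      by (rule AE_PiM_component[where P = "\<lambda>x. if j = s then x = M \<or> x = 1 else x = 1 \<or> x = 0", OF _ j])
        (use * in \<open>auto simp: prob_space_two_point\<close>)
  qed simp
  then have "(\<integral>\<^sup>+v. ennreal (obtained_reward (Suc N) (\<lambda>i. c i v) v) \<partial>?X) \<le> (\<integral>\<^sup>+v. f v \<partial>?X)"
  proof (intro nn_integral_mono_AE, eventually_elim)
    case (elim v)
    then have "\<And>j. j \<le> N \<Longrightarrow> j \<noteq> s \<Longrightarrow> v j = 1 \<or> v j = 0" "v s = M \<or> v s = 1"
      using s by (metis lessThan_iff less_Suc_eq_le)+
    then show ?case
      unfolding f_def using s M c by (intro obtained_reward_le) auto
  qed
  \<comment> \<open>The special reward is drawn into the dummy coordinate of \<open>P\<close>, so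
    that \<open>run_prob\<close> and \<open>take_prob\<close> apply.\<close>
  also have "\<dots> = (\<integral>\<^sup>+v. \<integral>\<^sup>+y. f (v(s := y)) \<partial>two_point \<epsilon> M 1 \<partial>P)"
    unfolding P_def using s by (intro nn_integral_PiM_resample prob_space_two_point f_meas) auto
  also have "\<dots> = (\<integral>\<^sup>+v. (\<Sum>i<s. ?early i v) + ennreal (\<epsilon> * M) * ?run v + ennreal (1 - \<epsilon>) * ?win v \<partial>P)"
  proof (intro nn_integral_cong)
    fix v assume v: "v \<in> space P"
    have upd: "(\<lambda>y. v(s := y)) \<in> borel \<rightarrow>\<^sub>M ?E"
    proof -
      have "(\<lambda>_. v) \<in> borel \<rightarrow>\<^sub>M ?E"
        using v by (intro measurable_const) (simp add: sets_eq_imp_space_eq[OF sets_P])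
      then show ?thesis
        using s by (intro measurable_fun_upd[where J = "{..<Suc N}"]) auto
    qed
    have early_upd: "(\<Sum>i<s. ?early i (v(s := y))) = (\<Sum>i<s. ?early i v)" for y
      by (intro sum.cong) (auto simp: indicator_def)
    \<comment> \<open>With \<open>1\<close> written into coordinate \<open>s\<close>,
      \<open>stops s\<close> turns into \<open>takes_one s\<close>.\<close>
    have f1: "f (v(s := 1)) = (\<Sum>i<s. ?early i v) + ?win v"
      unfolding f_def early_upd by (auto simp: indicator_def takes_one_def)
    have fM: "f (v(s := M)) = (\<Sum>i<s. ?early i v) + ennreal M * ?run v"
      unfolding f_def early_upd using M by (auto simp: indicator_def)
    have "(\<integral>\<^sup>+y. f (v(s := y)) \<partial>two_point \<epsilon> M 1) = ennreal \<epsilon> * f (v(s := M)) + ennreal (1 - \<epsilon>) * f (v(s := 1))"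
      using \<epsilon> by (intro nn_integral_two_point measurable_compose[OF upd f_meas])
    also have "\<dots> = (ennreal \<epsilon> + ennreal (1 - \<epsilon>)) * (\<Sum>i<s. ?early i v)
        + ennreal \<epsilon> * ennreal M * ?run v + ennreal (1 - \<epsilon>) * ?win v"
      unfolding f1 fM by (simp only: distrib_left distrib_right ac_simps)
    also have "ennreal \<epsilon> + ennreal (1 - \<epsilon>) = 1"
      using \<epsilon> by (simp flip: ennreal_plus)
    also have "ennreal \<epsilon> * ennreal M = ennreal (\<epsilon> * M)"
      using \<epsilon> M by (simp add: ennreal_mult)
    finally show "(\<integral>\<^sup>+y. f (v(s := y)) \<partial>two_point \<epsilon> M 1)
        = (\<Sum>i<s. ?early i v) + ennreal (\<epsilon> * M) * ?run v + ennreal (1 - \<epsilon>) * ?win v"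
      unfolding mult_1_left .
  qed
  also have "\<dots> = (\<Sum>i<s. \<integral>\<^sup>+v. ?early i v \<partial>P) + ennreal (\<epsilon> * M) * (\<integral>\<^sup>+v. ?run v \<partial>P)
      + ennreal (1 - \<epsilon>) * (\<integral>\<^sup>+v. ?win v \<partial>P)"
  proof -
    have indP: "(\<lambda>v. indicator {v. Q v} v :: ennreal) \<in> borel_measurable P" if "Measurable.pred ?E Q" for Q
      using ind[OF that] unfolding measurable_cong_sets[OF sets_P refl] .
    have m: "?early i \<in> borel_measurable P" if "i \<in> {..<s}" for i
      using that by (intro indP early) auto
    have m2: "?run \<in> borel_measurable P" "?win \<in> borel_measurable P"
      by (intro indP run win order.refl)+
    have "(\<lambda>v. \<Sum>i<s. ?early i v) \<in> borel_measurable P"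
      by (intro borel_measurable_sum m)
    moreover have "(\<integral>\<^sup>+v. (\<Sum>i<s. ?early i v) \<partial>P) = (\<Sum>i<s. \<integral>\<^sup>+v. ?early i v \<partial>P)"
      by (intro nn_integral_sum m)
    ultimately show ?thesis
      using m2 by (simp add: nn_integral_add nn_integral_cmult del: nn_integral_indicator)
  qed
  also have "(\<Sum>i<s. \<integral>\<^sup>+v. ?early i v \<partial>P) = (\<Sum>i<s. ennreal (p * take_prob i))"
  proof (intro sum.cong refl)
    fix i assume "i \<in> {..<s}"
    then have i: "i < s" "i \<le> N"
      using s by auto
    show "(\<integral>\<^sup>+v. ?early i v \<partial>P) = ennreal (p * take_prob i)"
      unfolding nn_integral_indicator_P[OF early[OF i(1)]] prob_stop_at_one[OF i(2)] ..
  qed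
  also have "\<dots> = ennreal (p * (\<Sum>i<s. take_prob i))"
    using p_nonneg by (simp add: sum_ennreal take_prob_def sum_distrib_left)
  also have "(\<integral>\<^sup>+v. ?run v \<partial>P) = ennreal (run_prob s)"
    unfolding run_prob_def by (intro nn_integral_indicator_P run order.refl)
  also have "(\<integral>\<^sup>+v. ?win v \<partial>P)
      = ennreal (take_prob s + (run_prob s - take_prob s) * (1 - (1 - p) ^ (N - s)))" (is "_ = ennreal ?w")
    unfolding nn_integral_indicator_P[OF win] prob_take_or_later_one[OF s] ..
  also have "ennreal (p * (\<Sum>i<s. take_prob i)) + ennreal (\<epsilon> * M) * ennreal (run_prob s) + ennreal (1 - \<epsilon>) * ennreal ?w
      = ennreal (p * (\<Sum>i<s. take_prob i) + \<epsilon> * M * run_prob s + (1 - \<epsilon>) * ?w)"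
  proof -
    have "0 \<le> p * (\<Sum>i<s. take_prob i)" "0 \<le> run_prob s" "0 \<le> ?w" "0 \<le> \<epsilon> * M"
      using p_nonneg \<epsilon> M prob_take_or_later_one[OF s, symmetric]
      by (auto simp: take_prob_def run_prob_def intro!: mult_nonneg_nonneg sum_nonneg)
    then show ?thesis
      using \<epsilon> by (simp add: ennreal_mult ennreal_plus)
  qed
  finally show ?thesis .
qed

end

subsection \<open>The hard instance\<close>

text \<open>
  \<open>special_box_at s\<close> maps a step to the box arriving then, with the special box \<open>0\<close> at step \<open>s\<close>;
  hence the arrival order in the sense of the definitions is its inverse.
\<close>

definition special_box_at :: "nat \<Rightarrow> nat \<Rightarrow> nat" where
  "special_box_at s i = (if i < s then Suc i else if i = s then 0 else i)"

lemma special_box_at_permutes: "s \<le> N \<Longrightarrow> special_box_at s permutes {..<Suc N}"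
proof (rule bij_imp_permutes)
  assume "s \<le> N"
  then show "bij_betw (special_box_at s) {..<Suc N} {..<Suc N}"
    by (intro bij_betw_byWitness[where f' = "\<lambda>k. if k = 0 then s else if k \<le> s then k - 1 else k"])
      (auto simp: special_box_at_def)
qed (auto simp: special_box_at_def)

text \<open>The right-hand side is free of \<open>s\<close>: here ignorance of the order enters. The
  case \<open>i = s\<close> belongs here because the decision at step \<open>s\<close> sees only the
  identities before it.\<close>

lemma map_special_box_at: "i \<le> s \<Longrightarrow> map (special_box_at s) [0..<i] = [1..<Suc i]"
  by (intro nth_equalityI) (auto simp: special_box_at_def simp del: upt_Suc)

lemma inv_inv_special_box_at: "s \<le> N \<Longrightarrow> inv (inv (special_box_at s)) = special_box_at s"
  by (intro inv_inv_eq permutes_bij[OF special_box_at_permutes])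

definition hard_boxes :: boxes where
  "hard_boxes = two_point (1 / 1000) 1000 1 # replicate 100 (two_point (1 / 101) 1 0)"

lemma length_hard_boxes [simp]: "length hard_boxes = Suc 100"
  by (simp add: hard_boxes_def)

lemma nth_hard_boxes:
  "k < Suc 100 \<Longrightarrow> hard_boxes ! k = (if k = 0 then two_point (1 / 1000) 1000 1 else two_point (1 / 101) 1 0)"
  by (cases k) (simp_all add: hard_boxes_def)

definition rewards_dist :: "nat \<Rightarrow> (nat \<Rightarrow> real) measure" where
  "rewards_dist s = PiM {..<Suc 100} (\<lambda>i. if i = s then two_point (1 / 1000) 1000 1 else two_point (1 / 101) 1 0)"

lemma prob_space_rewards_dist: "prob_space (rewards_dist s)"
  unfolding rewards_dist_def by (intro prob_space_PiM) (simp add: prob_space_two_point)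

lemma sets_rewards_dist: "sets (rewards_dist s) = sets (PiM {..<Suc 100} (\<lambda>_. borel))"
  unfolding rewards_dist_def by (intro sets_PiM_cong) auto

lemma arrival_dist_hard_boxes:
  assumes "s \<le> 100"
  shows "arrival_dist hard_boxes (inv (special_box_at s)) = rewards_dist s"
proof -
  have "hard_boxes ! special_box_at s i
      = (if i = s then two_point (1 / 1000) 1000 1 else two_point (1 / 101) 1 0)" if "i < Suc 100" for i
    using that assms by (subst nth_hard_boxes) (auto simp: special_box_at_def)
  then show ?thesis
    unfolding arrival_dist_def rewards_dist_def length_hard_boxes inv_inv_special_box_at[OF assms] by (intro PiM_cong) auto
qed

section \<open>Admissibility and the order-aware benchmark\<close>

lemma nn_integral_rewards_dist_component:
  assumes "s \<le> 100"
  shows "(\<integral>\<^sup>+v. ennreal (v s) \<partial>rewards_dist s) = ennreal (1999 / 1000)"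
proof -
  have f: "(\<lambda>v. ennreal (v s)) \<in> borel_measurable (PiM {..<Suc 100} (\<lambda>_. borel))"
    using assms by (intro measurable_compose[OF _ measurable_ennreal] measurable_component_singleton) auto
  have "(\<integral>\<^sup>+v. ennreal (v s) \<partial>rewards_dist s)
      = (\<integral>\<^sup>+v. \<integral>\<^sup>+y. ennreal ((v(s := y)) s) \<partial>two_point (1 / 1000) 1000 1
          \<partial>PiM {..<Suc 100} (\<lambda>_. two_point (1 / 101) 1 0))"
    unfolding rewards_dist_def using assms
    by (intro nn_integral_PiM_resample f prob_space_two_point) auto
  also have "\<dots> = (\<integral>\<^sup>+y. ennreal y \<partial>two_point (1 / 1000) 1000 1)"
    by (simp add: prob_space.emeasure_space_1[OF prob_space_PiM] prob_space_two_point)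
  also have "\<dots> = ennreal (1 / 1000) * ennreal 1000 + ennreal (1 - 1 / 1000) * ennreal 1"
    by (intro nn_integral_two_point) auto
  also have "\<dots> = ennreal (1999 / 1000)"
    by (simp flip: ennreal_mult ennreal_plus ennreal_numeral ennreal_1)
  finally show ?thesis .
qed

lemma AE_rewards_dist: "AE v in rewards_dist s. \<forall>j\<in>{..<Suc 100}. 0 \<le> v j \<and> v j \<le> 1000"
proof (intro AE_finite_allI)
  fix j :: nat assume j: "j \<in> {..<Suc 100}"
  have *: "AE x in two_point (1 / 1000) 1000 1. 0 \<le> x \<and> x \<le> 1000"
    "AE x in two_point (1 / 101) 1 0. 0 \<le> x \<and> x \<le> 1000"
    by (rule AE_two_pointI; simp)+
  show "AE v in rewards_dist s. 0 \<le> v j \<and> v j \<le> 1000"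
    unfolding rewards_dist_def
    by (rule AE_PiM_component[where P = "\<lambda>x. 0 \<le> x \<and> x \<le> 1000", OF _ j])
      (use * in \<open>simp_all add: prob_space_two_point\<close>)
qed simp

lemma admissible_hard_boxes: "admissible hard_boxes"
proof -
  have "reward_dist (two_point q x y)" if "0 \<le> x" "0 \<le> y" for q x y
    unfolding reward_dist_def using that by (intro conjI prob_space_two_point AE_two_pointI) auto
  then have "\<forall>M\<in>set hard_boxes. reward_dist M"
    by (auto simp: hard_boxes_def)
  moreover have dist: "PiM {..<Suc 100} (\<lambda>k. hard_boxes ! k) = rewards_dist 0"
    unfolding rewards_dist_def by (intro PiM_cong) (auto simp: nth_hard_boxes)
  have "(\<integral>\<^sup>+v. ennreal (v 0) \<partial>rewards_dist 0) \<le> expected_max hard_boxes"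
    unfolding expected_max_def length_hard_boxes dist
    by (intro nn_integral_mono ennreal_leI Max_ge) auto
  then have "0 < expected_max hard_boxes"
    unfolding nn_integral_rewards_dist_component[OF le0] by (rule less_le_trans[rotated]) simp
  moreover have "expected_max hard_boxes \<le> (\<integral>\<^sup>+v. ennreal 1000 \<partial>rewards_dist 0)"
    unfolding expected_max_def length_hard_boxes dist
  proof (intro nn_integral_mono_AE, use AE_rewards_dist in eventually_elim)
    case (elim v)
    then have "Max (v ` {..<Suc 100}) \<le> 1000"
      by (intro Max.boundedI) (auto simp: lessThan_empty_iff)
    then show ?case
      by (rule ennreal_leI)
  qed
  then have "expected_max hard_boxes \<le> ennreal 1000"
    by (simp add: prob_space.emeasure_space_1[OF prob_space_rewards_dist])
  then have "expected_max hard_boxes < \<infinity>"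
    by (rule le_less_trans) simp
  ultimately show ?thesis
    by (simp add: admissible_def)
qed

text \<open>Waiting for the special box is one online rule; a lower bound suffices because this
  value is a denominator.\<close>

lemma expected_opt_hard_boxes:
  assumes "s \<le> 100"
  shows "ennreal (1999 / 1000) \<le> expected_opt hard_boxes (inv (special_box_at s))"
proof -
  \<comment> \<open>At step \<open>i\<close> the list has \<open>Suc i\<close> entries, so this rule
    stops exactly at step \<open>s\<close>.\<close>
  let ?d = "\<lambda>l :: real list. length l = Suc s"
  have "obtained_reward (Suc 100) (\<lambda>i. ?d (map v [0..<Suc i])) v = v s" for v
  proof -
    have "(LEAST i. i < Suc 100 \<and> i = s) = s"
      using assms by (intro Least_equality) auto
    then show ?thesis
      using assms by (simp add: obtained_reward_def)
  qed
  then have "expected_online_reward hard_boxes (inv (special_box_at s)) ?d = ennreal (1999 / 1000)"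
    unfolding expected_online_reward_def arrival_dist_hard_boxes[OF assms] length_hard_boxes
    using nn_integral_rewards_dist_component[OF assms] by simp
  moreover have "online_rule (length hard_boxes) ?d"
    by (simp add: online_rule_def)
  ultimately show ?thesis
    unfolding expected_opt_def by (intro SUP_upper2[where i = ?d]) auto
qed

text \<open>Replacing \<open>LEAST\<close> by a finite sum reduces measurability of the reward to
  that of the decisions and coordinates.\<close>

lemma obtained_reward_eq_sum:
  "obtained_reward n c v = (\<Sum>i<n. if c i \<and> (\<forall>j<i. \<not> c j) then v i else 0)"
proof (cases "\<exists>i<n. c i")
  case True
  define t where "t = (LEAST i. i < n \<and> c i)"
  have t: "t < n" "c t"
    using LeastI_ex[of "\<lambda>i. i < n \<and> c i"] True by (auto simp: t_def)
  have before: "\<not> c j" if "j < t" for j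
    using not_less_Least[of j "\<lambda>i. i < n \<and> c i"] that t by (auto simp: t_def)
  have "(c i \<and> (\<forall>j<i. \<not> c j)) \<longleftrightarrow> i = t" for i
    using t before by (metis linorder_neqE_nat)
  then have "(\<Sum>i<n. if c i \<and> (\<forall>j<i. \<not> c j) then v i else 0) = v t"
    using t by (simp add: sum.delta)
  then show ?thesis
    using True by (simp add: obtained_reward_def t_def)
next
  case False
  then have "(\<Sum>i<n. if c i \<and> (\<forall>j<i. \<not> c j) then v i else 0) = 0"
    by (intro sum.neutral) auto
  with False show ?thesis
    unfolding obtained_reward_def by (simp only: if_False)
qed

lemma obtained_reward_measurable:
  assumes c: "\<And>i. i < n \<Longrightarrow> Measurable.pred M (\<lambda>x. c x i)"
    and v: "\<And>i. i < n \<Longrightarrow> (\<lambda>x. v x i) \<in> borel_measurable M"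
  shows "(\<lambda>x. obtained_reward n (c x) (v x)) \<in> borel_measurable M"
proof -
  have "Measurable.pred M (\<lambda>x. c x i \<and> (\<forall>j\<in>{..<i}. \<not> c x j))" if "i < n" for i
    using that by (intro pred_intros_logic pred_intros_finite c) auto
  then have "(\<lambda>x. \<Sum>i<n. if c x i \<and> (\<forall>j\<in>{..<i}. \<not> c x j) then v x i else 0) \<in> borel_measurable M"
    by (intro borel_measurable_sum measurable_If v borel_measurable_const) auto
  then show ?thesis
    by (simp add: obtained_reward_eq_sum Ball_def)
qed

section \<open>Averaging over seeds and arrival times\<close>

theorem theorem2:
  fixes ALG :: "'w id_algorithm"
  assumes "identity_truthful ALG"
  shows "truthfulness_ratio ALG \<le> ennreal 0.81"
proof -
  let ?S = "seed ALG hard_boxes"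
  let ?E = "PiM {..<Suc 100} (\<lambda>_. borel :: real measure)"
  let ?acc = "\<lambda>\<omega> ids v. accept ALG hard_boxes \<omega> ids (map v [0..<Suc (length ids)])"
  define p \<epsilon> :: real where "p = 1 / 101" and "\<epsilon> = 1 / 1000"
  define w where "w = order_weight p"
  define K where "K = p * (\<Sum>i<100. growth p i) + (2 - \<epsilon>) * growth p 100"
  define alg where "alg s = expected_alg ALG hard_boxes (inv (special_box_at s))" for s
  \<comment> \<open>A fixed seed leaves a deterministic algorithm; this is its expected reward when
    the special box arrives at step \<open>s\<close>.\<close>
  define cond_alg where "cond_alg s \<omega> = (\<integral>\<^sup>+v. ennreal (obtained_reward (Suc 100)
      (\<lambda>i. accept ALG hard_boxes \<omega> (map (special_box_at s) [0..<i]) (map v [0..<Suc i])) v) \<partial>rewards_dist s)" for s \<omega>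
  have S: "prob_space ?S"
    and acc: "distinct ids \<Longrightarrow> set ids \<subseteq> {..<Suc 100} \<Longrightarrow> length ids < Suc 100 \<Longrightarrow>
       Measurable.pred (?S \<Otimes>\<^sub>M ?E) (\<lambda>(\<omega>, v). ?acc \<omega> ids v)" for ids
    using assms admissible_hard_boxes unfolding identity_truthful_def by auto
  interpret S: prob_space ?S
    by (rule S)
  have \<epsilon>: "0 \<le> \<epsilon>" "\<epsilon> \<le> 1" "\<epsilon> * 1000 = 1"
    by (simp_all add: \<epsilon>_def)
  have w: "0 \<le> w j" for j
    unfolding w_def by (intro order_weight_nonneg) (auto simp: p_def)

  have alg: "alg s = (\<integral>\<^sup>+\<omega>. cond_alg s \<omega> \<partial>?S)" and cond_alg: "cond_alg s \<in> borel_measurable ?S"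
    if s: "s \<le> 100" for s
  proof -
    interpret D: prob_space "rewards_dist s"
      by (rule prob_space_rewards_dist)
    let ?f = "\<lambda>(\<omega>, v). ennreal (obtained_reward (Suc 100)
      (\<lambda>i. accept ALG hard_boxes \<omega> (map (special_box_at s) [0..<i]) (map v [0..<Suc i])) v)"
    have "Measurable.pred (?S \<Otimes>\<^sub>M ?E)
        (\<lambda>x. accept ALG hard_boxes (fst x) (map (special_box_at s) [0..<i]) (map (snd x) [0..<Suc i]))"
      if "i < Suc 100" for i
    proof -
      have "distinct (map (special_box_at s) [0..<i])"
        using permutes_inj_on[OF special_box_at_permutes[OF s]] by (simp add: distinct_map)
      moreover have "set (map (special_box_at s) [0..<i]) \<subseteq> {..<Suc 100}"
        using s that by (auto simp: special_box_at_def)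
      ultimately show ?thesis
        using acc[of "map (special_box_at s) [0..<i]"] that by (simp add: split_beta')
    qed
    moreover have "(\<lambda>x. snd x i) \<in> borel_measurable (?S \<Otimes>\<^sub>M ?E)" if "i < Suc 100" for i
      using that by (intro measurable_compose[OF measurable_snd measurable_component_singleton]) auto
    ultimately have "(\<lambda>x. obtained_reward (Suc 100) (\<lambda>i. accept ALG hard_boxes (fst x)
        (map (special_box_at s) [0..<i]) (map (snd x) [0..<Suc i])) (snd x)) \<in> borel_measurable (?S \<Otimes>\<^sub>M ?E)"
      by (rule obtained_reward_measurable)
    then have "?f \<in> borel_measurable (?S \<Otimes>\<^sub>M ?E)"
      unfolding split_beta' by (rule measurable_compose[OF _ measurable_ennreal])
    then have f: "?f \<in> borel_measurable (?S \<Otimes>\<^sub>M rewards_dist s)"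
      unfolding measurable_cong_sets[OF sets_pair_measure_cong[OF refl sets_rewards_dist] refl] .
    show "alg s = (\<integral>\<^sup>+\<omega>. cond_alg s \<omega> \<partial>?S)"
      using D.nn_integral_fst[OF f]
      unfolding alg_def expected_alg_def arrival_dist_hard_boxes[OF s] length_hard_boxes inv_inv_special_box_at[OF s] cond_alg_def
      by simp
    show "cond_alg s \<in> borel_measurable ?S"
      using D.borel_measurable_nn_integral_fst[OF f] by (simp add: cond_alg_def[abs_def])
  qed

  \<comment> \<open>Yao's principle: the averaged bound holds for each seed separately. The index
    \<open>j\<close> counts the Bernoulli boxes after the special box, which thus arrives at step
    \<open>100 - j\<close>.\<close>
  have pointwise: "(\<Sum>j\<le>100. ennreal (w j) * cond_alg (100 - j) \<omega>) \<le> ennreal K"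
    if \<omega>: "\<omega> \<in> space ?S" for \<omega>
  proof -
    \<comment> \<open>At step \<open>i\<close>, a run without the special box has shown exactly the
      identities \<open>1\<close> to \<open>i\<close>.\<close>
    define rule where "rule = (\<lambda>i. accept ALG hard_boxes \<omega> [1..<Suc i])"
    interpret R: stopping_rule 100 p rule
    proof
      fix i :: nat assume "i \<le> 100"
      then have "Measurable.pred (?S \<Otimes>\<^sub>M ?E) (\<lambda>(\<omega>, v). ?acc \<omega> [1..<Suc i] v)"
        by (intro acc) auto
      from measurable_compose[OF measurable_Pair1'[OF \<omega>] this]
      show "Measurable.pred ?E (\<lambda>v. rule i (map v [0..<Suc i]))"
        by (simp add: rule_def del: upt_Suc)
    qed (simp_all add: p_def)
    \<comment> \<open>This is \<open>R\<close> of \<open>weighted_reward_le\<close>; the coefficient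
      of \<open>R.run_prob s\<close> is \<open>\<epsilon> * 1000 = 1\<close>.\<close>
    define r where "r s = p * (\<Sum>i<s. R.take_prob i) + R.run_prob s
        + (1 - \<epsilon>) * (R.take_prob s + (R.run_prob s - R.take_prob s) * (1 - (1 - p) ^ (100 - s)))" for s
    have prob: "0 \<le> R.take_prob i" "0 \<le> R.run_prob i" for i
      by (simp_all add: R.take_prob_def R.run_prob_def)
    have r: "cond_alg s \<omega> \<le> ennreal (r s)" if s: "s \<le> 100" for s
    proof -
      have "accept ALG hard_boxes \<omega> (map (special_box_at s) [0..<i]) (map v [0..<Suc i]) \<longleftrightarrow> R.stops i v"
        if "i \<le> s" for i v
        unfolding R.stops_def map_special_box_at[OF that] unfolding rule_def ..
      from R.expected_reward_le[where M = 1000, OF s _ \<epsilon>(1,2) this]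
      show ?thesis
        unfolding cond_alg_def rewards_dist_def r_def p_def[symmetric] \<epsilon>_def[symmetric]
        by (simp add: \<epsilon>(3) del: upt_Suc)
    qed
    have r_nonneg: "0 \<le> r s" if "s \<le> 100" for s
      unfolding r_def using prob R.take_prob_le_run_prob[OF that]
      by (intro add_nonneg_nonneg mult_nonneg_nonneg sum_nonneg) (auto simp: p_def \<epsilon>_def power_le_one)
    have "(\<Sum>j\<le>100. ennreal (w j) * cond_alg (100 - j) \<omega>) \<le> (\<Sum>j\<le>100. ennreal (w j) * ennreal (r (100 - j)))"
      by (intro sum_mono mult_left_mono r) auto
    also have "\<dots> = ennreal (\<Sum>j\<le>100. w j * r (100 - j))"
      using w r_nonneg by (simp add: sum_ennreal flip: ennreal_mult)
    also have "\<dots> \<le> ennreal K"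
      unfolding w_def K_def
      using R.run_prob_Suc_le R.take_prob_le_run_prob R.run_prob_0
      by (intro ennreal_leI weighted_reward_le[where n = R.run_prob and q = R.take_prob])
        (auto simp: p_def \<epsilon>_def r_def)
    finally show ?thesis .
  qed

  have "(\<Sum>j\<le>100. ennreal (w j) * alg (100 - j))
      = (\<integral>\<^sup>+\<omega>. (\<Sum>j\<le>100. ennreal (w j) * cond_alg (100 - j) \<omega>) \<partial>?S)"
    using alg cond_alg by (simp add: nn_integral_sum nn_integral_cmult)
  also have "\<dots> \<le> (\<integral>\<^sup>+\<omega>. ennreal K \<partial>?S)"
    by (intro nn_integral_mono pointwise)
  also have "\<dots> = ennreal K"
    by (simp add: S.emeasure_space_1)
  finally have total: "(\<Sum>j\<le>100. ennreal (w j) * alg (100 - j)) \<le> ennreal K" .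

  \<comment> \<open>If every order reached this threshold, the weighted sum would exceed
    \<open>K\<close>.\<close>
  have "\<exists>s\<le>100. alg s < ennreal (0.81 * (2 - \<epsilon>))"
  proof (rule ccontr)
    assume "\<not> (\<exists>s\<le>100. alg s < ennreal (0.81 * (2 - \<epsilon>)))"
    then have "ennreal (0.81 * (2 - \<epsilon>)) \<le> alg s" if "s \<le> 100" for s
      using that by (auto simp: not_less)
    then have "(\<Sum>j\<le>100. ennreal (w j) * ennreal (0.81 * (2 - \<epsilon>))) \<le> (\<Sum>j\<le>100. ennreal (w j) * alg (100 - j))"
      by (intro sum_mono mult_left_mono) auto
    also have "(\<Sum>j\<le>100. ennreal (w j) * ennreal (0.81 * (2 - \<epsilon>))) = ennreal (0.81 * (2 - \<epsilon>) * (\<Sum>j\<le>100. w j))"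
    proof -
      have "(\<Sum>j\<le>100. ennreal (w j) * ennreal x) = ennreal (x * (\<Sum>j\<le>100. w j))" if "0 \<le> x" for x
        using w that by (simp add: sum_ennreal sum_distrib_left mult.commute flip: ennreal_mult)
      then show ?thesis
        using \<epsilon> by simp
    qed
    finally have "ennreal (0.81 * (2 - \<epsilon>) * (\<Sum>j\<le>100. w j)) \<le> ennreal K"
      using total by (rule order_trans)
    moreover have "K < 0.81 * (2 - \<epsilon>) * (\<Sum>j\<le>100. w j)"
      using weighted_reward_bound_less by (simp add: K_def w_def p_def \<epsilon>_def)
    \<comment> \<open>Since \<open>ennreal\<close> sends negative reals to \<open>0\<close>, a
      negative \<open>K\<close> is treated separately; the total weight is positive because the
      weight at \<open>0\<close> is \<open>1\<close>.\<close>
    moreover have "0 < 0.81 * (2 - \<epsilon>) * (\<Sum>j\<le>100. w j)" if "K < 0"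
      using w by (intro mult_pos_pos) (auto simp: \<epsilon>_def w_def order_weight_def intro!: sum_pos2[of _ 0])
    ultimately show False
      by (auto simp: ennreal_le_iff2)
  qed
  then obtain s where s: "s \<le> 100" and "alg s < ennreal (0.81 * (2 - \<epsilon>))"
    by blast
  then have alg_le: "alg s \<le> ennreal 0.81 * ennreal (1999 / 1000)"
    by (simp add: \<epsilon>_def flip: ennreal_mult)
  let ?\<pi> = "inv (special_box_at s)"
  have \<pi>: "?\<pi> \<in> arrival_orders hard_boxes"
    unfolding arrival_orders_def using special_box_at_permutes[OF s] by (simp add: permutes_inv)
  note opt = expected_opt_hard_boxes[OF s]
  have "alg s \<le> expected_opt hard_boxes ?\<pi> * ennreal 0.81"
    using alg_le mult_right_mono[OF opt, of "ennreal 0.81"] by (simp add: mult.commute)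
  moreover have "0 < expected_opt hard_boxes ?\<pi>"
    using opt by (rule less_le_trans[rotated]) simp
  ultimately have ratio: "expected_alg ALG hard_boxes ?\<pi> / expected_opt hard_boxes ?\<pi> \<le> ennreal 0.81"
    unfolding alg_def by (intro divide_le_posI_ennreal)
  have "finite (arrival_orders hard_boxes)"
    by (simp add: arrival_orders_def finite_permutations)
  then have "(MIN \<pi> \<in> arrival_orders hard_boxes. expected_alg ALG hard_boxes \<pi> / expected_opt hard_boxes \<pi>)
      \<le> ennreal 0.81"
    using \<pi> ratio by (meson Min_le finite_imageI imageI order_trans)
  then show ?thesis
    unfolding truthfulness_ratio_def using admissible_hard_boxes by (intro INF_lower2[of hard_boxes]) auto
qed

end
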